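(* Let $k$ be an odd positive integer and let $G$ be a multigraph with maximum degree $\Delta(G)$. Then $\bigl\lceil\frac{\Delta(G)}{k}\bigr\rceil\le\chi'_k(G)\le\mathit{ch}'_k(G)\le\bigl\lceil\frac{3\,\Delta(G)}{3k-1}\bigr\rceil$.
   Context: Multigraphs are finite, may have multiple edges, but have no loops. For an integer $k\ge1$, a $k$-frugal edge colouring of a multigraph $G$ is a (possibly improper) colouring of its edges such that no colour appears more than $k$ times on the edges incident with any vertex. $\chi'_k(G)$ is the least number of colours in a $k$-frugal edge colouring of $G$. $\mathit{ch}'_k(G)$ is the least $t$ such that whenever each edge $e$ is given a list $L(e)$ of $t$ colours, there is a $k$-frugal edge colouring of $G$ in which each edge $e$ receives a colour from $L(e)$. *)

theory Defs
  imports Complex_Main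
begin

record ('v, 'e) multigraph =
  verts :: "'v set"
  edges :: "'e set"
  endpoints :: "'e \<Rightarrow> 'v set"

text \<open>Edges are objects of their own, so distinct edges may have the same pair of endpoints;
  loops are excluded because every edge has two distinct endpoints.\<close>

definition is_multigraph :: "('v, 'e) multigraph \<Rightarrow> bool" where
  "is_multigraph G \<longleftrightarrow>
     finite (verts G) \<and> finite (edges G) \<and>
     (\<forall>e\<in>edges G. endpoints G e \<subseteq> verts G \<and> card (endpoints G e) = 2)"

definition incident_edges :: "('v, 'e) multigraph \<Rightarrow> 'v \<Rightarrow> 'e set" where
  "incident_edges G v = {e \<in> edges G. v \<in> endpoints G e}"

definition degree :: "('v, 'e) multigraph \<Rightarrow> 'v \<Rightarrow> nat" where
  "degree G v = card (incident_edges G v)"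

text \<open>The inserted 0 matters only for the graph without vertices, whose maximum degree is
  thereby 0.\<close>

definition max_degree :: "('v, 'e) multigraph \<Rightarrow> nat" where
  "max_degree G = Max (insert 0 (degree G ` verts G))"

definition frugal_edge_colouring :: "nat \<Rightarrow> ('v, 'e) multigraph \<Rightarrow> ('e \<Rightarrow> 'c) \<Rightarrow> bool" where
  "frugal_edge_colouring k G c \<longleftrightarrow>
     (\<forall>v\<in>verts G. \<forall>a. card {e \<in> incident_edges G v. c e = a} \<le> k)"

definition frugal_chromatic_index :: "nat \<Rightarrow> ('v, 'e) multigraph \<Rightarrow> nat" where
  "frugal_chromatic_index k G =
     (LEAST t. \<exists>c :: 'e \<Rightarrow> nat. (\<forall>e\<in>edges G. c e < t) \<and> frugal_edge_colouring k G c)"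

text \<open>A list of \<open>t\<close> colours is a set of \<open>t\<close> colours. Colours are natural numbers; since a finite
  graph has finitely many edges, only finitely many colours occur in the lists of its edges, so
  any infinite palette gives the same number. Finiteness is stated because \<open>card\<close> is 0 on
  infinite sets.\<close>

definition frugally_edge_choosable :: "nat \<Rightarrow> ('v, 'e) multigraph \<Rightarrow> nat \<Rightarrow> bool" where
  "frugally_edge_choosable k G t \<longleftrightarrow>
     (\<forall>L :: 'e \<Rightarrow> nat set. (\<forall>e\<in>edges G. finite (L e) \<and> card (L e) = t) \<longrightarrow>
        (\<exists>c. (\<forall>e\<in>edges G. c e \<in> L e) \<and> frugal_edge_colouring k G c))"

definition frugal_choice_index :: "nat \<Rightarrow> ('v, 'e) multigraph \<Rightarrow> nat" where
  "frugal_choice_index k G = (LEAST t. frugally_edge_choosable k G t)"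

end

theory Submission
  imports Defs
begin

text \<open>Write \<open>k = 2 * m + 1\<close> and let all lists have \<open>t\<close> colours, where \<open>3 * \<Delta> \<le> t * (3 * k - 1)\<close>,
  that is, \<open>\<Delta> \<le> 2 * m * t + 2 * t / 3\<close>. By Eulerian-type orientations the edges split into a class of
  maximum degree at most \<open>2 * m * t\<close> and a class of maximum degree about \<open>2 * t / 3\<close>. The first is
  \<open>2 * m\<close>-frugally colourable from the lists, by Galvin's theorem on an orientation; the second is
  properly colourable from the same lists, by the list version of Shannon's theorem of Borodin,
  Kostochka and Woodall: colour the edges inside the two sides of a maximum cut greedily, and the
  edges of the cut by the bipartite theorem in which an edge needs only as many colours as the
  larger of the degrees of its two ends. The two colourings together are \<open>k\<close>-frugal.\<close>

section \<open>List edge colourings of bipartite multigraphs\<close>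

text \<open>Halmos-Vaughan induction: a tight nonempty proper subfamily is matched within its own
  union and the rest outside that union. If no such subfamily is tight, each has an element to
  spare, so any element may be given to one index and deleted from the other sets.\<close>

lemma hall_marriage:
  fixes A :: "'i \<Rightarrow> 'a set"
  assumes "finite I" and "\<And>i. i \<in> I \<Longrightarrow> finite (A i)"
    and "\<And>J. J \<subseteq> I \<Longrightarrow> card J \<le> card (\<Union>(A ` J))"
  shows "\<exists>R. inj_on R I \<and> (\<forall>i\<in>I. R i \<in> A i)"
  using assms
proof (induction "card I" arbitrary: I A rule: less_induct)
  case less
  note fin = less.prems(1) and finA = less.prems(2) and hall = less.prems(3)
  show ?case
  proof (cases "I = {}")
    case False
    then obtain i0 where i0: "i0 \<in> I" by blast
    show ?thesis
    proof (cases "\<exists>J. J \<subset> I \<and> J \<noteq> {} \<and> card (\<Union>(A ` J)) \<le> card J")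
      case True
      then obtain J where J: "J \<subset> I" "J \<noteq> {}" "card (\<Union>(A ` J)) \<le> card J" by blast
      define U where "U = \<Union>(A ` J)"
      have finJ: "finite J" using J fin finite_subset by blast
      have finU: "finite U" unfolding U_def using finJ J finA by blast
      have "\<exists>R. inj_on R J \<and> (\<forall>i\<in>J. R i \<in> A i)"
      proof (rule less.hyps)
        show "card J < card I" by (rule psubset_card_mono[OF fin J(1)])
        show "finite J" by (rule finJ)
        show "finite (A i)" if "i \<in> J" for i using that J finA by blast
        show "card S \<le> card (\<Union>(A ` S))" if "S \<subseteq> J" for S
          by (rule hall) (use that J in blast)
      qed
      then obtain R1 where R1: "inj_on R1 J" "\<And>i. i \<in> J \<Longrightarrow> R1 i \<in> A i" by blast
      have "\<exists>R. inj_on R (I - J) \<and> (\<forall>i\<in>I - J. R i \<in> A i - U)"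
      proof (rule less.hyps)
        show "card (I - J) < card I"
          by (rule psubset_card_mono[OF fin]) (use J in blast)
        show "finite (I - J)" using fin by blast
        show "finite (A i - U)" if "i \<in> I - J" for i using that finA by blast
        fix S assume S: "S \<subseteq> I - J"
        have finS: "finite S" using S fin finite_subset by blast
        \<comment> \<open>Hall's condition for \<open>S\<close> and \<open>J\<close> together leaves
          enough for \<open>S\<close> once the at most \<open>card J\<close> elements of
          \<open>U\<close> are removed.\<close>
        have "card S + card J = card (S \<union> J)"
          using S finS finJ by (subst card_Un_disjoint) auto
        also have "\<dots> \<le> card (\<Union>(A ` (S \<union> J)))" by (rule hall) (use S J in blast)
        also have "\<Union>(A ` (S \<union> J)) = \<Union>((\<lambda>i. A i - U) ` S) \<union> U" unfolding U_def by blast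
        also have "card \<dots> \<le> card (\<Union>((\<lambda>i. A i - U) ` S)) + card U" by (rule card_Un_le)
        also have "card U \<le> card J" using J(3) U_def by simp
        finally show "card S \<le> card (\<Union>((\<lambda>i. A i - U) ` S))" by simp
      qed
      then obtain R2 where R2: "inj_on R2 (I - J)" "\<And>i. i \<in> I - J \<Longrightarrow> R2 i \<in> A i - U" by blast
      have R1U: "R1 i \<in> U" if "i \<in> J" for i using R1(2) that unfolding U_def by blast
      show ?thesis
      proof (intro exI[of _ "\<lambda>i. if i \<in> J then R1 i else R2 i"] conjI ballI)
        show "inj_on (\<lambda>i. if i \<in> J then R1 i else R2 i) I"
        proof (rule inj_onI)
          fix i j assume "i \<in> I" "j \<in> I"
            "(if i \<in> J then R1 i else R2 i) = (if j \<in> J then R1 j else R2 j)"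
          then show "i = j"
            using R1U R2(2) inj_onD[OF R1(1)] inj_onD[OF R2(1)]
            by (cases "i \<in> J"; cases "j \<in> J") force+
        qed
      qed (use R1 R2 in auto)
    next
      case strict: False
      have "A i0 \<noteq> {}" using hall[of "{i0}"] i0 by auto
      then obtain a where a: "a \<in> A i0" by blast
      have "\<exists>R. inj_on R (I - {i0}) \<and> (\<forall>i\<in>I - {i0}. R i \<in> A i - {a})"
      proof (rule less.hyps)
        show "card (I - {i0}) < card I" using i0 fin by (meson card_Diff1_less)
        show "finite (I - {i0})" using fin by blast
        show "finite (A i - {a})" if "i \<in> I - {i0}" for i using that finA by blast
        fix S assume S: "S \<subseteq> I - {i0}"
        show "card S \<le> card (\<Union>((\<lambda>i. A i - {a}) ` S))"
        proof (cases "S = {}")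
          case False
          moreover have "S \<subset> I" using S i0 by blast
          ultimately have "card S < card (\<Union>(A ` S))" using strict by (meson not_le)
          moreover have "\<Union>((\<lambda>i. A i - {a}) ` S) = \<Union>(A ` S) - {a}" by blast
          ultimately show ?thesis by (auto simp: card_Diff_singleton_if)
        qed simp
      qed
      then obtain R where R: "inj_on R (I - {i0})" "\<And>i. i \<in> I - {i0} \<Longrightarrow> R i \<in> A i - {a}" by blast
      show ?thesis
      proof (intro exI[of _ "R(i0 := a)"] conjI ballI)
        show "inj_on (R(i0 := a)) I"
        proof (rule inj_onI)
          fix i j assume "i \<in> I" "j \<in> I" "(R(i0 := a)) i = (R(i0 := a)) j"
          then show "i = j"
            using R(2) inj_onD[OF R(1)] by (cases "i = i0"; cases "j = i0") force+
        qed
      qed (use R a in auto)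
    qed
  qed simp
qed

section \<open>Preferences bounded by the larger end degree\<close>

text \<open>A bipartite multigraph is given by its edge set \<open>E\<close> and the maps \<open>x\<close> and \<open>y\<close> from edges to
  their ends; at an end, edges with smaller \<open>p\<close> or \<open>q\<close> are preferred. Galvin's kernel argument
  colours every edge whose list is larger than its number of preferred adjacent edges.\<close>

definition good_preferences ::
  "'e set \<Rightarrow> ('e \<Rightarrow> 'a) \<Rightarrow> ('e \<Rightarrow> 'b) \<Rightarrow> ('e \<Rightarrow> int) \<Rightarrow> ('e \<Rightarrow> int) \<Rightarrow> bool" where
  "good_preferences E x y p q \<longleftrightarrow>
     (\<forall>e\<in>E. \<forall>f\<in>E. e \<noteq> f \<longrightarrow> (x e = x f \<longrightarrow> p e \<noteq> p f) \<and> (y e = y f \<longrightarrow> q e \<noteq> q f)) \<and>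
     (\<forall>e\<in>E. card {f \<in> E. x f = x e \<and> p f < p e} + card {f \<in> E. y f = y e \<and> q f < q e}
        < max (card {f \<in> E. x f = x e}) (card {f \<in> E. y f = y e}))"

lemma good_preferences_commute: "good_preferences E x y p q \<longleftrightarrow> good_preferences E y x q p"
  unfolding good_preferences_def by (simp add: max.commute add.commute conj_commute)

text \<open>The matching \<open>M\<close> is put on top of the preferences at \<open>x\<close> and at the bottom at \<open>y\<close>. The count of
  an edge outside \<open>M\<close> grows only if its \<open>x\<close>-end is covered, and then its bound grows as well.\<close>

lemma good_preferences_insert_matching:
  fixes x :: "'e \<Rightarrow> 'a" and y :: "'e \<Rightarrow> 'b"
  assumes fin: "finite E" and ME: "M \<subseteq> E"
    and inj: "inj_on x M" "inj_on y M"
    and closed: "\<And>f. f \<in> E - M \<Longrightarrow> x f \<in> x ` M \<Longrightarrow>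
        y f \<in> y ` M \<or> card {g \<in> E. y g = y f} < card {g \<in> E. x g = x f}"
    and good: "good_preferences (E - M) x y p q"
  shows "\<exists>p q. good_preferences E x y p q"
proof -
  obtain lo where lo: "\<And>e. e \<in> E \<Longrightarrow> lo < p e"
  proof
    fix e assume "e \<in> E"
    then have "Min (p ` E) \<le> p e" using fin by (intro Min_le) auto
    then show "Min (p ` E) - 1 < p e" by linarith
  qed
  obtain hi where hi: "\<And>e. e \<in> E \<Longrightarrow> q e < hi"
  proof
    fix e assume "e \<in> E"
    then have "q e \<le> Max (q ` E)" using fin by (intro Max_ge) auto
    then show "q e < Max (q ` E) + 1" by linarith
  qed
  \<comment> \<open>All edges of \<open>M\<close> may share one value on each side, since distinct
    edges of \<open>M\<close> have no common end.\<close>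
  define p' where "p' = (\<lambda>e. if e \<in> M then lo else p e)"
  define q' where "q' = (\<lambda>e. if e \<in> M then hi else q e)"
  have "good_preferences E x y p' q'"
    unfolding good_preferences_def
  proof (intro conjI ballI impI)
    fix e f assume ef: "e \<in> E" "f \<in> E" "e \<noteq> f"
    have old: "(x e = x f \<longrightarrow> p e \<noteq> p f) \<and> (y e = y f \<longrightarrow> q e \<noteq> q f)" if "e \<notin> M" "f \<notin> M"
      using good that ef unfolding good_preferences_def by blast
    show "p' e \<noteq> p' f" if "x e = x f"
      using that ef old inj_onD[OF inj(1), of e f] lo[OF ef(1)] lo[OF ef(2)] unfolding p'_def
      by (cases "e \<in> M"; cases "f \<in> M") auto
    show "q' e \<noteq> q' f" if "y e = y f"
      using that ef old inj_onD[OF inj(2), of e f] hi[OF ef(1)] hi[OF ef(2)] unfolding q'_def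
      by (cases "e \<in> M"; cases "f \<in> M") auto
  next
    fix e assume e: "e \<in> E"
    let ?X = "{f \<in> E. x f = x e}" and ?Y = "{f \<in> E. y f = y e}"
    let ?X' = "{f \<in> E - M. x f = x e}" and ?Y' = "{f \<in> E - M. y f = y e}"
    let ?P = "{f \<in> E. x f = x e \<and> p' f < p' e}" and ?Q = "{f \<in> E. y f = y e \<and> q' f < q' e}"
    show "card ?P + card ?Q < max (card ?X) (card ?Y)"
    proof (cases "e \<in> M")
      case True
      have P: "?P = {}" using lo True unfolding p'_def by force
      have "?Q \<subset> ?Y" using e by auto
      then have "card ?Q < card ?Y" using fin by (intro psubset_card_mono) auto
      then show ?thesis unfolding P card.empty by linarith
    next
      case False
      let ?P' = "{f \<in> E - M. x f = x e \<and> p f < p e}" and ?Q' = "{f \<in> E - M. y f = y e \<and> q f < q e}"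
      have old: "card ?P' + card ?Q' < max (card ?X') (card ?Y')"
        using good e False unfolding good_preferences_def by blast
      have Q: "?Q = ?Q'" using False hi[OF e] unfolding q'_def by force
      have le: "card ?X' \<le> card ?X" "card ?Y' \<le> card ?Y" using fin by (auto intro!: card_mono)
      show ?thesis
      proof (cases "x e \<in> x ` M")
        case True
        then obtain g where g: "g \<in> M" "x g = x e" by force
        have gu: "h = g" if "h \<in> M" "x h = x e" for h
          using inj(1) g that by (metis inj_on_def)
        have sub: "?P \<subseteq> insert g ?P'" using gu False unfolding p'_def by auto
        have "finite ?P'" using fin by simp
        then have "card ?P \<le> card (insert g ?P')" by (intro card_mono[OF _ sub]) simp
        also have "\<dots> \<le> Suc (card ?P')" using fin g by simp
        finally have P: "card ?P \<le> Suc (card ?P')" .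
        have X: "card ?X = Suc (card ?X')"
        proof -
          have "?X = insert g ?X'" using gu g ME by blast
          then show ?thesis using fin g by simp
        qed
        from closed[of e] e False True
        have "y e \<in> y ` M \<or> card ?Y < card ?X" by simp
        \<comment> \<open>The bound must rise to pay for \<open>g\<close>. The degree at
          \<open>x e\<close> does rise; if it is the larger one, that suffices, and otherwise the
          degree at \<open>y e\<close> rises too.\<close>
        then have "max (card ?X') (card ?Y') < max (card ?X) (card ?Y)"
        proof
          assume "y e \<in> y ` M"
          then obtain h where h: "h \<in> M" "y h = y e" by force
          have "?Y' \<subset> ?Y" using h ME by auto
          then have "card ?Y' < card ?Y" using fin by (intro psubset_card_mono) auto
          then show ?thesis using X by auto
        next
          assume "card ?Y < card ?X"
          then show ?thesis using X le by auto
        qed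
        then show ?thesis unfolding Q using P old by linarith
      next
        case False2: False
        have P: "?P = ?P'" using False False2 unfolding p'_def by (auto simp: image_iff)
        show ?thesis unfolding P Q using old le by linarith
      qed
    qed
  qed
  then show ?thesis by blast
qed

text \<open>The matching is sought in the set \<open>K\<close> of edges with both ends of maximum degree: either Hall's
  condition matches all of \<open>y ` K\<close>, or a minimal violating set minus a point is matched onto all of
  its neighbours in \<open>K\<close>.\<close>

lemma bipartite_preferences_exist:
  fixes x :: "'e \<Rightarrow> 'a" and y :: "'e \<Rightarrow> 'b"
  assumes "finite E"
  shows "\<exists>p q. good_preferences E x y p q"
  using assms
proof (induction "card E" arbitrary: E rule: less_induct)
  case less
  note fin = less.prems
  define dx where "dx e = card {f \<in> E. x f = x e}" for e
  define dy where "dy e = card {f \<in> E. y f = y e}" for e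
  have IH: "\<exists>p q. good_preferences (E - M) x y p q" if "M \<subseteq> E" "M \<noteq> {}" for M
    by (rule less.hyps) (use that fin in \<open>auto intro!: psubset_card_mono\<close>)
  have step_x: ?case
    if "M \<subseteq> E" "M \<noteq> {}" "inj_on x M" "inj_on y M"
      "\<And>f. f \<in> E - M \<Longrightarrow> x f \<in> x ` M \<Longrightarrow> y f \<in> y ` M \<or> dy f < dx f" for M
    using good_preferences_insert_matching[OF fin that(1,3,4)] that(5) IH[OF that(1,2)]
    unfolding dx_def dy_def by blast
  \<comment> \<open>By symmetry the matching may also be put on top at \<open>y\<close> and at the
    bottom at \<open>x\<close>.\<close>
  have step_y: ?case
    if "M \<subseteq> E" "M \<noteq> {}" "inj_on x M" "inj_on y M"
      "\<And>f. f \<in> E - M \<Longrightarrow> y f \<in> y ` M \<Longrightarrow> x f \<in> x ` M \<or> dx f < dy f" for M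
    using good_preferences_insert_matching[OF fin that(1,4,3)] that(5) IH[OF that(1,2)]
    unfolding dx_def dy_def good_preferences_commute[of _ x y] by blast
  show ?case
  proof (cases "E = {}")
    case True
    then show ?thesis unfolding good_preferences_def by simp
  next
    case False
    define D where "D = Max ((\<lambda>e. max (dx e) (dy e)) ` E)"
    have le_D: "dx e \<le> D" "dy e \<le> D" if "e \<in> E" for e
      using Max_ge[of "(\<lambda>e. max (dx e) (dy e)) ` E" "max (dx e) (dy e)"] that fin
      unfolding D_def by auto
    have "D \<in> (\<lambda>e. max (dx e) (dy e)) ` E"
      unfolding D_def by (rule Max_in) (use fin False in auto)
    then obtain e0 where e0: "e0 \<in> E" "max (dx e0) (dy e0) = D" by auto
    define K where "K = {e \<in> E. dx e = D \<and> dy e = D}"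
    have dx_cong: "dx e = dx f" if "x e = x f" for e f using that unfolding dx_def by simp
    have dy_cong: "dy e = dy f" if "y e = y f" for e f using that unfolding dy_def by simp
    \<comment> \<open>An edge with one end of degree \<open>D\<close> is in \<open>K\<close> or has
      smaller degree at its other end; the latter is the strict alternative in the conditions of
      \<open>step_x\<close> and \<open>step_y\<close>.\<close>
    have inK: "f \<in> K" if "f \<in> E" "\<not> dx f < D" "\<not> dy f < D" for f
      using that le_D[of f] unfolding K_def by auto
    show ?thesis
    proof (cases "K = {}")
      case True
      show ?thesis
      \<comment> \<open>With \<open>K\<close> empty, a single edge at an end of degree
        \<open>D\<close> is matching enough: every other edge there has smaller degree at its other
        end.\<close>
      proof (cases "dx e0 = D")
        case t: True
        show ?thesis
        proof (rule step_x[of "{e0}"])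
          fix f assume f: "f \<in> E - {e0}" "x f \<in> x ` {e0}"
          then have "dx f = D" using dx_cong[of f e0] t by auto
          then show "y f \<in> y ` {e0} \<or> dy f < dx f" using True inK[of f] f by auto
        qed (use e0 in auto)
      next
        case False
        then have t: "dy e0 = D" using e0 by linarith
        show ?thesis
        proof (rule step_y[of "{e0}"])
          fix f assume f: "f \<in> E - {e0}" "y f \<in> y ` {e0}"
          then have "dy f = D" using dy_cong[of f e0] t by auto
          then show "x f \<in> x ` {e0} \<or> dx f < dy f" using True inK[of f] f by auto
        qed (use e0 in auto)
      qed
    next
      case False
      define N where "N j = x ` {e \<in> K. y e = j}" for j
      have finK: "finite K" using fin unfolding K_def by simp
      have finN: "finite (N j)" for j using finK unfolding N_def by simp
      have matching: "\<exists>M \<subseteq> K. inj_on x M \<and> inj_on y M \<and> y ` M = T"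
        if T: "finite T" and hall: "\<And>J. J \<subseteq> T \<Longrightarrow> card J \<le> card (\<Union>(N ` J))" for T
      proof -
        obtain R where R: "inj_on R T" "\<And>j. j \<in> T \<Longrightarrow> R j \<in> N j"
          using hall_marriage[where A = N, OF T finN] hall by blast
        have "\<exists>e. e \<in> K \<and> y e = j \<and> x e = R j" if "j \<in> T" for j
          using R(2)[OF that] unfolding N_def by auto
        then obtain g where g: "\<And>j. j \<in> T \<Longrightarrow> g j \<in> K \<and> y (g j) = j \<and> x (g j) = R j"
          by metis
        show ?thesis
        proof (intro exI[of _ "g ` T"] conjI)
          show "inj_on x (g ` T)" using g R(1) unfolding inj_on_def by force
          show "inj_on y (g ` T)" using g unfolding inj_on_def by force
          show "y ` g ` T = T" using g by force
          show "g ` T \<subseteq> K" using g by blast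
        qed
      qed
      show ?thesis
      proof (cases "\<forall>T \<subseteq> y ` K. card T \<le> card (\<Union>(N ` T))")
        case True
        then obtain M where M: "M \<subseteq> K" "inj_on x M" "inj_on y M" "y ` M = y ` K"
          using matching[of "y ` K"] finK by blast
        show ?thesis
        proof (rule step_x[of M])
          fix f assume f: "f \<in> E - M" "x f \<in> x ` M"
          then obtain g where g: "g \<in> M" "x f = x g" by auto
          then have "dx f = D" using M(1) dx_cong[OF g(2)] unfolding K_def by auto
          then show "y f \<in> y ` M \<or> dy f < dx f" using inK[of f] f M(4) by auto
        qed (use M False K_def in auto)
      next
        case False
        then obtain T0 where "T0 \<subseteq> y ` K \<and> card (\<Union>(N ` T0)) < card T0" by force
        from ex_has_least_nat[of "\<lambda>T. T \<subseteq> y ` K \<and> card (\<Union>(N ` T)) < card T", OF this, of card]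
        obtain T where T: "T \<subseteq> y ` K" "card (\<Union>(N ` T)) < card T"
          and min: "\<And>S. S \<subseteq> y ` K \<Longrightarrow> card (\<Union>(N ` S)) < card S \<Longrightarrow> card T \<le> card S" by blast
        have finT: "finite T" using T finK finite_subset by blast
        have "T \<noteq> {}" using T by auto
        then obtain j0 where j0: "j0 \<in> T" by blast
        obtain M where M: "M \<subseteq> K" "inj_on x M" "inj_on y M" "y ` M = T - {j0}"
        proof -
          have "card J \<le> card (\<Union>(N ` J))" if J: "J \<subseteq> T - {j0}" for J
          proof (rule ccontr)
            assume "\<not> ?thesis"
            then have "card T \<le> card J" using min[of J] J T by auto
            moreover have "card J < card T" using J j0 finT by (intro psubset_card_mono) auto
            ultimately show False by simp
          qed
          then show ?thesis using matching[of "T - {j0}"] finT that by blast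
        qed
        have sub: "x ` M \<subseteq> \<Union>(N ` T)" using M unfolding N_def by blast
        have finU: "finite (\<Union>(N ` T))" using finT finN by blast
        \<comment> \<open>\<open>M\<close> has \<open>card T - 1\<close> edges and \<open>T\<close>
          has at most that many neighbours, so \<open>M\<close> covers all of them.\<close>
        have "card (x ` M) = card T - 1"
          using M finT j0 by (metis card_Diff_singleton card_image)
        then have xM: "x ` M = \<Union>(N ` T)"
          using card_seteq[OF finU sub] T by simp
        \<comment> \<open>A singleton \<open>T\<close> would make \<open>M\<close> empty. It cannot
          occur: \<open>j0\<close> is an end of an edge of \<open>K\<close> and so has a
          neighbour.\<close>
        obtain e where "e \<in> K" "y e = j0" using j0 T by auto
        then have "x e \<in> x ` M" unfolding xM using j0 unfolding N_def by blast
        then have "M \<noteq> {}" by blast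
        show ?thesis
        proof (rule step_y[of M])
          fix f assume f: "f \<in> E - M" "y f \<in> y ` M"
          then obtain g where g: "g \<in> M" "y f = y g" by auto
          then have d: "dy f = D" using M(1) dy_cong[OF g(2)] unfolding K_def by auto
          have "y f \<in> T" using f M(4) by blast
          then have "f \<in> K \<Longrightarrow> x f \<in> x ` M" unfolding xM N_def by blast
          then show "x f \<in> x ` M \<or> dx f < dy f" using inK[of f] f d by auto
        qed (use M \<open>M \<noteq> {}\<close> K_def in auto)
      qed
    qed
  qed
qed

section \<open>Stable matchings and Galvin's induction\<close>

text \<open>If the favourite edges of the \<open>x\<close>-ends are not a matching, then one that loses at its
  \<open>y\<close>-end can be deleted: it stays dominated in every stable matching of the rest.\<close>

lemma stable_matching_exists:
  fixes p :: "'e \<Rightarrow> 'o::linorder" and q :: "'e \<Rightarrow> 'o2::linorder"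
  assumes "finite E"
    and "\<And>e f. e \<in> E \<Longrightarrow> f \<in> E \<Longrightarrow> x e = x f \<Longrightarrow> p e = p f \<Longrightarrow> e = f"
    and "\<And>e f. e \<in> E \<Longrightarrow> f \<in> E \<Longrightarrow> y e = y f \<Longrightarrow> q e = q f \<Longrightarrow> e = f"
  shows "\<exists>S \<subseteq> E. inj_on x S \<and> inj_on y S \<and>
    (\<forall>e\<in>E - S. \<exists>f\<in>S. x f = x e \<and> p f < p e \<or> y f = y e \<and> q f < q e)"
  using assms
proof (induction "card E" arbitrary: E rule: less_induct)
  case less
  note fin = less.prems(1) and px = less.prems(2) and qy = less.prems(3)
  define S where "S = {e \<in> E. \<forall>f\<in>E. x f = x e \<longrightarrow> p e \<le> p f}"
  have best: "\<exists>f\<in>S. x f = x e \<and> p f \<le> p e" if e: "e \<in> E" for e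
  proof -
    let ?P = "p ` {f \<in> E. x f = x e}"
    have fP: "finite ?P" "?P \<noteq> {}" using fin e by auto
    from Min_in[OF this] obtain f where f: "f \<in> E" "x f = x e" "p f = Min ?P" by auto
    then have "p f \<le> p g" if "g \<in> E" "x g = x e" for g using that fP by auto
    then show ?thesis using f e unfolding S_def by auto
  qed
  have injx: "inj_on x S"
    unfolding S_def by (rule inj_onI) (auto intro!: px antisym)
  show ?case
  proof (cases "inj_on y S")
    case True
    show ?thesis
    proof (intro exI[of _ S] conjI ballI)
      fix e assume e: "e \<in> E - S"
      obtain f where f: "f \<in> S" "x f = x e" "p f \<le> p e" using best e by blast
      then have "p f \<noteq> p e" using px[of f e] e unfolding S_def by blast
      then show "\<exists>f\<in>S. x f = x e \<and> p f < p e \<or> y f = y e \<and> q f < q e" using f by force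
    qed (use injx True S_def in auto)
  next
    case False
    then obtain e f where ef: "e \<in> S" "f \<in> S" "e \<noteq> f" "y e = y f" "q f < q e"
      using qy unfolding inj_on_def S_def
      by (metis (no_types, lifting) linorder_neqE mem_Collect_eq)
    have eE: "e \<in> E" "f \<in> E" using ef unfolding S_def by auto
    have "\<exists>T \<subseteq> E - {e}. inj_on x T \<and> inj_on y T \<and>
        (\<forall>g\<in>E - {e} - T. \<exists>h\<in>T. x h = x g \<and> p h < p g \<or> y h = y g \<and> q h < q g)"
      by (rule less.hyps) (use fin eE px qy card_Diff1_less[OF fin eE(1)] in auto)
    then obtain T where T: "T \<subseteq> E - {e}" "inj_on x T" "inj_on y T"
      "\<And>g. g \<in> E - {e} - T \<Longrightarrow> \<exists>h\<in>T. x h = x g \<and> p h < p g \<or> y h = y g \<and> q h < q g" by blast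
    \<comment> \<open>If \<open>f\<close> is not in \<open>T\<close>, the edge dominating it cannot
      win at the \<open>x\<close>-end, where \<open>f\<close> is a favourite. So it wins at the
      \<open>y\<close>-end, where it beats \<open>f\<close> and hence \<open>e\<close>.\<close>
    have "\<exists>h\<in>T. y h = y e \<and> q h < q e"
    proof (cases "f \<in> T")
      case True
      then show ?thesis using ef by auto
    next
      case False
      then obtain h where h: "h \<in> T" "x h = x f \<and> p h < p f \<or> y h = y f \<and> q h < q f"
        using T(4)[of f] eE ef by blast
      moreover have "\<not> (x h = x f \<and> p h < p f)" using h T ef unfolding S_def by force
      ultimately show ?thesis using ef by force
    qed
    then have "\<exists>h\<in>T. x h = x g \<and> p h < p g \<or> y h = y g \<and> q h < q g" if "g \<in> E - T" for g
      using T(4)[of g] that by (cases "g = e") blast+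
    then show ?thesis using T by blast
  qed
qed

text \<open>Fix a colour \<open>a\<close>, give it to a stable matching \<open>S\<close> of the
  edges with \<open>a\<close> in their lists, and delete \<open>S\<close> and \<open>a\<close>. A
  remaining edge that loses \<open>a\<close> from its list also loses a preferred neighbour, so the
  inequality survives.\<close>

lemma list_colouring_of_preferences:
  fixes L :: "'e \<Rightarrow> 'c set" and p :: "'e \<Rightarrow> 'o::linorder" and q :: "'e \<Rightarrow> 'o2::linorder"
  assumes "finite E"
    and "\<And>e f. e \<in> E \<Longrightarrow> f \<in> E \<Longrightarrow> x e = x f \<Longrightarrow> p e = p f \<Longrightarrow> e = f"
    and "\<And>e f. e \<in> E \<Longrightarrow> f \<in> E \<Longrightarrow> y e = y f \<Longrightarrow> q e = q f \<Longrightarrow> e = f"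
    and "\<And>e. e \<in> E \<Longrightarrow>
      card {f \<in> E. x f = x e \<and> p f < p e} + card {f \<in> E. y f = y e \<and> q f < q e} < card (L e)"
  shows "\<exists>c. (\<forall>e\<in>E. c e \<in> L e) \<and>
    (\<forall>e\<in>E. \<forall>f\<in>E. e \<noteq> f \<longrightarrow> x e = x f \<or> y e = y f \<longrightarrow> c e \<noteq> c f)"
  using assms
proof (induction "card E" arbitrary: E L rule: less_induct)
  case less
  note fin = less.prems(1) and px = less.prems(2) and qy = less.prems(3) and bound = less.prems(4)
  show ?case
  proof (cases "E = {}")
    case False
    then obtain e0 where e0: "e0 \<in> E" by blast
    then have "L e0 \<noteq> {}" using bound[of e0] by auto
    then obtain a where a: "a \<in> L e0" by blast
    let ?Ea = "{e \<in> E. a \<in> L e}"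
    have "\<exists>S \<subseteq> ?Ea. inj_on x S \<and> inj_on y S \<and>
        (\<forall>e\<in>?Ea - S. \<exists>f\<in>S. x f = x e \<and> p f < p e \<or> y f = y e \<and> q f < q e)"
      by (rule stable_matching_exists) (use fin px qy in auto)
    then obtain S where S: "S \<subseteq> ?Ea" "inj_on x S" "inj_on y S"
      and dom: "\<And>e. e \<in> ?Ea - S \<Longrightarrow> \<exists>f\<in>S. x f = x e \<and> p f < p e \<or> y f = y e \<and> q f < q e"
      by blast
    \<comment> \<open>\<open>e0\<close> is in \<open>S\<close> or dominated by it, so the induction
      makes progress.\<close>
    have "S \<noteq> {}" using dom[of e0] e0 a by blast
    have "\<exists>c. (\<forall>e\<in>E - S. c e \<in> L e - {a}) \<and>
      (\<forall>e\<in>E - S. \<forall>f\<in>E - S. e \<noteq> f \<longrightarrow> x e = x f \<or> y e = y f \<longrightarrow> c e \<noteq> c f)"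
    proof (rule less.hyps)
      show "card (E - S) < card E" using S \<open>S \<noteq> {}\<close> fin by (intro psubset_card_mono) auto
      fix e assume e: "e \<in> E - S"
      let ?P = "{f \<in> E. x f = x e \<and> p f < p e}" and ?Q = "{f \<in> E. y f = y e \<and> q f < q e}"
      let ?P' = "{f \<in> E - S. x f = x e \<and> p f < p e}" and ?Q' = "{f \<in> E - S. y f = y e \<and> q f < q e}"
      have finPQ: "finite ?P" "finite ?Q" using fin by auto
      have le: "card ?P' \<le> card ?P" "card ?Q' \<le> card ?Q" using fin by (auto intro!: card_mono)
      show "card ?P' + card ?Q' < card (L e - {a})"
      proof (cases "a \<in> L e")
        case True
        then obtain f where f: "f \<in> S" "x f = x e \<and> p f < p e \<or> y f = y e \<and> q f < q e"
          using dom[of e] e by blast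
        have fE: "f \<in> E" using f S by blast
        from f(2) have "card ?P' + card ?Q' < card ?P + card ?Q"
        proof
          assume "x f = x e \<and> p f < p e"
          then have "?P' \<subset> ?P" using f fE by auto
          from psubset_card_mono[OF finPQ(1) this] le show ?thesis by linarith
        next
          assume "y f = y e \<and> q f < q e"
          then have "?Q' \<subset> ?Q" using f fE by auto
          from psubset_card_mono[OF finPQ(2) this] le show ?thesis by linarith
        qed
        then show ?thesis using bound[of e] e True by (simp add: card_Diff_singleton)
      next
        case False
        then show ?thesis using bound[of e] e le by simp
      qed
    qed (use fin px qy in auto)
    then obtain c where c: "\<And>e. e \<in> E - S \<Longrightarrow> c e \<in> L e - {a}"
      "\<And>e f. e \<in> E - S \<Longrightarrow> f \<in> E - S \<Longrightarrow> e \<noteq> f \<Longrightarrow> x e = x f \<or> y e = y f \<Longrightarrow> c e \<noteq> c f"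
      by blast
    show ?thesis
    proof (intro exI[of _ "\<lambda>e. if e \<in> S then a else c e"] conjI ballI impI)
      show "(if e \<in> S then a else c e) \<in> L e" if "e \<in> E" for e
        using that c(1)[of e] S(1) by auto
      fix e f assume ef: "e \<in> E" "f \<in> E" "e \<noteq> f" "x e = x f \<or> y e = y f"
      then have "\<not> (e \<in> S \<and> f \<in> S)" using inj_onD[OF S(2)] inj_onD[OF S(3)] by blast
      then show "(if e \<in> S then a else c e) \<noteq> (if f \<in> S then a else c f)"
        using c(1)[of e] c(1)[of f] c(2)[of e f] ef by auto
    qed
  qed simp
qed

text \<open>Each list is measured only against the two ends of its own edge. This local form stays
  applicable when lists have been shortened unevenly by edges coloured earlier.\<close>

lemma bipartite_list_edge_colouring:
  fixes L :: "'e \<Rightarrow> 'c set" and x :: "'e \<Rightarrow> 'a" and y :: "'e \<Rightarrow> 'b"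
  assumes "finite E"
    and "\<And>e. e \<in> E \<Longrightarrow> card {f \<in> E. x f = x e} \<le> card (L e)"
    and "\<And>e. e \<in> E \<Longrightarrow> card {f \<in> E. y f = y e} \<le> card (L e)"
  shows "\<exists>c. (\<forall>e\<in>E. c e \<in> L e) \<and>
    (\<forall>e\<in>E. \<forall>f\<in>E. e \<noteq> f \<longrightarrow> x e = x f \<or> y e = y f \<longrightarrow> c e \<noteq> c f)"
proof -
  obtain p q where pq: "good_preferences E x y p q"
    using bipartite_preferences_exist[OF assms(1)] by blast
  show ?thesis
  proof (rule list_colouring_of_preferences[OF assms(1)])
    fix e assume e: "e \<in> E"
    then have "card {f \<in> E. x f = x e \<and> p f < p e} + card {f \<in> E. y f = y e \<and> q f < q e}
        < max (card {f \<in> E. x f = x e}) (card {f \<in> E. y f = y e})"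
      using pq unfolding good_preferences_def by blast
    then show "card {f \<in> E. x f = x e \<and> p f < p e} + card {f \<in> E. y f = y e \<and> q f < q e}
        < card (L e)" using assms(2,3)[OF e] by linarith
  qed (use pq in \<open>auto simp: good_preferences_def\<close>)
qed

section \<open>Orientations and degree splitting\<close>

text \<open>Two edges \<open>uv\<close> and \<open>vw\<close> are replaced by one edge \<open>uw\<close>, whose orientation is then routed
  through \<open>v\<close>. Loops may arise and contribute 0 to the sum.\<close>

lemma balanced_signed_orientation:
  fixes a b :: "'e \<Rightarrow> 'v"
  assumes "finite E"
  shows "\<exists>s t. (\<forall>e\<in>E. s e = a e \<and> t e = b e \<or> s e = b e \<and> t e = a e) \<and>
    (\<forall>v. \<bar>\<Sum>e\<in>E. of_bool (s e = v) - of_bool (t e = v)\<bar> \<le> (1::int))"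
  using assms
proof (induction "card E" arbitrary: E a b rule: less_induct)
  case less
  note fin = less.prems
  show ?case
  proof (cases "\<exists>e\<in>E. \<exists>f\<in>E. e \<noteq> f \<and> {a e, b e} \<inter> {a f, b f} \<noteq> {}")
    case True
    then obtain e f v where ef: "e \<in> E" "f \<in> E" "e \<noteq> f" and v: "v \<in> {a e, b e}" "v \<in> {a f, b f}"
      by blast
    obtain u where u: "a e = u \<and> b e = v \<or> a e = v \<and> b e = u" using v(1) by (metis insertE singletonD)
    obtain w where w: "a f = w \<and> b f = v \<or> a f = v \<and> b f = w" using v(2) by (metis insertE singletonD)
    have "\<exists>s t. (\<forall>g\<in>E - {f}. s g = (a(e := u)) g \<and> t g = (b(e := w)) g \<or>
          s g = (b(e := w)) g \<and> t g = (a(e := u)) g) \<and>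
        (\<forall>v. \<bar>\<Sum>g\<in>E - {f}. of_bool (s g = v) - of_bool (t g = v)\<bar> \<le> (1::int))"
      by (rule less.hyps) (use fin card_Diff1_less[OF fin ef(2)] in simp_all)
    then obtain s' t' where
      or': "\<And>g. g \<in> E - {f} \<Longrightarrow> s' g = (a(e := u)) g \<and> t' g = (b(e := w)) g \<or>
          s' g = (b(e := w)) g \<and> t' g = (a(e := u)) g" and
      bal': "\<And>v. \<bar>\<Sum>g\<in>E - {f}. of_bool (s' g = v) - of_bool (t' g = v)\<bar> \<le> (1::int)"
      by blast
    \<comment> \<open>The merged edge is traversed through \<open>v\<close>: from \<open>u\<close>
      to \<open>v\<close> to \<open>w\<close> if it points from \<open>u\<close> to
      \<open>w\<close>, and in reverse otherwise. The two contributions at \<open>v\<close>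
      cancel.\<close>
    let ?fwd = "s' e = u \<and> t' e = w"
    define s where "s = s'(e := (if ?fwd then u else v), f := (if ?fwd then v else w))"
    define t where "t = t'(e := (if ?fwd then v else u), f := (if ?fwd then w else v))"
    have e': "s' e = u \<and> t' e = w \<or> s' e = w \<and> t' e = u" using or'[of e] ef by auto
    have sum_eq: "(\<Sum>g\<in>E. of_bool (s g = z) - of_bool (t g = z))
        = (\<Sum>g\<in>E - {f}. of_bool (s' g = z) - of_bool (t' g = z) :: int)" for z
    proof -
      let ?R = "E - {f} - {e}"
      have "(\<Sum>g\<in>E. of_bool (s g = z) - of_bool (t g = z)) =
          (of_bool (s f = z) - of_bool (t f = z)) + ((of_bool (s e = z) - of_bool (t e = z))
            + (\<Sum>g\<in>?R. of_bool (s g = z) - of_bool (t g = z) :: int))"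
        using fin ef by (subst sum.remove[of E f], simp, simp, subst sum.remove[of "E - {f}" e]) auto
      also have "(\<Sum>g\<in>?R. of_bool (s g = z) - of_bool (t g = z) :: int)
          = (\<Sum>g\<in>?R. of_bool (s' g = z) - of_bool (t' g = z))"
        by (rule sum.cong) (auto simp: s_def t_def)
      also have "(of_bool (s f = z) - of_bool (t f = z)) + ((of_bool (s e = z) - of_bool (t e = z)) + \<dots>)
          = (of_bool (s' e = z) - of_bool (t' e = z)) + \<dots>"
        using e' ef(3) unfolding s_def t_def by auto
      also have "\<dots> = (\<Sum>g\<in>E - {f}. of_bool (s' g = z) - of_bool (t' g = z))"
        using fin ef by (subst sum.remove[of "E - {f}" e]) auto
      finally show ?thesis .
    qed
    show ?thesis
    proof (rule exI[of _ s], rule exI[of _ t], intro conjI ballI allI)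
      fix g assume g: "g \<in> E"
      show "s g = a g \<and> t g = b g \<or> s g = b g \<and> t g = a g"
      proof -
        consider "g = e" | "g = f" | "g \<noteq> e" "g \<noteq> f" by blast
        then show ?thesis
        proof cases
          case 1
          have "s e = u \<and> t e = v \<or> s e = v \<and> t e = u" using ef(3) by (simp add: s_def t_def)
          then show ?thesis using u unfolding 1 by metis
        next
          case 2
          have "s f = v \<and> t f = w \<or> s f = w \<and> t f = v" by (simp add: s_def t_def)
          then show ?thesis using w unfolding 2 by metis
        next
          case 3
          then have "s g = s' g" "t g = t' g" by (simp_all add: s_def t_def)
          then show ?thesis using or'[of g] g 3 by simp
        qed
      qed
    next
      show "\<bar>\<Sum>g\<in>E. of_bool (s g = z) - of_bool (t g = z)\<bar> \<le> (1::int)" for z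
        unfolding sum_eq by (rule bal')
    qed
  next
    case False
    show ?thesis
    proof (rule exI[of _ a], rule exI[of _ b], intro conjI ballI allI)
      fix z
      show "\<bar>\<Sum>e\<in>E. of_bool (a e = z) - of_bool (b e = z)\<bar> \<le> (1::int)"
      proof (cases "\<exists>e\<in>E. z \<in> {a e, b e}")
        case True
        then obtain e where e: "e \<in> E" "z \<in> {a e, b e}" by blast
        \<comment> \<open>Distinct edges share no ends here, so only \<open>e\<close> contributes at
          \<open>z\<close>.\<close>
        have "(\<Sum>g\<in>E - {e}. of_bool (a g = z) - of_bool (b g = z)) = (0::int)"
          by (rule sum.neutral) (use False e in auto)
        then have "(\<Sum>e\<in>E. of_bool (a e = z) - of_bool (b e = z))
            = (of_bool (a e = z) - of_bool (b e = z) :: int)"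
          using sum.remove[OF fin e(1), of "\<lambda>e. of_bool (a e = z) - of_bool (b e = z) :: int"] by simp
        then show ?thesis by simp
      next
        case False
        then have "(\<Sum>e\<in>E. of_bool (a e = z) - of_bool (b e = z)) = (0::int)"
          by (intro sum.neutral) auto
        then show ?thesis by simp
      qed
    qed simp
  qed
qed

text \<open>In- and outdegree differ by at most 1 and add up to at most the even number
  \<open>2 * n\<close>, so neither can exceed \<open>n\<close>.\<close>

lemma orientation_halving_degrees:
  fixes ends :: "'e \<Rightarrow> 'v set"
  assumes fin: "finite E" and two: "\<And>e. e \<in> E \<Longrightarrow> card (ends e) = 2"
    and deg: "\<And>v. card {e \<in> E. v \<in> ends e} \<le> 2 * n"
  shows "\<exists>s t. (\<forall>e\<in>E. ends e = {s e, t e}) \<and>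
    (\<forall>v. card {e \<in> E. s e = v} \<le> n \<and> card {e \<in> E. t e = v} \<le> n)"
proof -
  have "\<forall>e\<in>E. \<exists>a b. ends e = {a, b} \<and> a \<noteq> b" using two by (meson card_2_iff)
  then obtain a b where ab: "\<And>e. e \<in> E \<Longrightarrow> ends e = {a e, b e} \<and> a e \<noteq> b e" by metis
  obtain s t where st: "\<And>e. e \<in> E \<Longrightarrow> s e = a e \<and> t e = b e \<or> s e = b e \<and> t e = a e"
    and bal: "\<And>v. \<bar>\<Sum>e\<in>E. of_bool (s e = v) - of_bool (t e = v)\<bar> \<le> (1::int)"
    using balanced_signed_orientation[OF fin, of a b] by blast
  have ends: "ends e = {s e, t e}" "s e \<noteq> t e" if "e \<in> E" for e
    using ab[OF that] st[OF that] by auto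
  have "card {e \<in> E. s e = v} \<le> n \<and> card {e \<in> E. t e = v} \<le> n" for v
  proof -
    have "{e \<in> E. v \<in> ends e} = {e \<in> E. s e = v} \<union> {e \<in> E. t e = v}" using ends by auto
    moreover have "{e \<in> E. s e = v} \<inter> {e \<in> E. t e = v} = {}" using ends(2) by fastforce
    ultimately have "card {e \<in> E. s e = v} + card {e \<in> E. t e = v} \<le> 2 * n"
      using deg[of v] fin by (simp add: card_Un_disjoint)
    moreover have "\<bar>int (card {e \<in> E. s e = v}) - int (card {e \<in> E. t e = v})\<bar> \<le> 1"
      using bal[of v] fin by (simp add: sum_subtractf Int_def)
    ultimately show ?thesis by linarith
  qed
  then show ?thesis using ends by blast
qed

text \<open>The edges at each vertex are numbered from 0 and cut into consecutive blocks of length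
  \<open>t\<close>.\<close>

lemma split_into_blocks:
  fixes s :: "'e \<Rightarrow> 'v"
  assumes fin: "finite E" and deg: "\<And>v. card {e \<in> E. s e = v} \<le> m * t"
  shows "\<exists>g :: 'e \<Rightarrow> nat. (\<forall>e\<in>E. g e < m) \<and> (\<forall>v i. card {e \<in> E. s e = v \<and> g e = i} \<le> t)"
proof -
  have "\<exists>h. bij_betw h {e \<in> E. s e = v} {0..<card {e \<in> E. s e = v}}" for v
    using fin by (intro ex_bij_betw_finite_nat) simp
  then obtain h where h: "\<And>v. bij_betw (h v) {e \<in> E. s e = v} {0..<card {e \<in> E. s e = v}}" by metis
  define g where "g e = h (s e) e div t" for e
  have "g e < m" if e: "e \<in> E" for e
  proof -
    have "h (s e) e < card {f \<in> E. s f = s e}" using bij_betwE[OF h[of "s e"]] e by auto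
    then have "h (s e) e < m * t" using deg[of "s e"] by linarith
    then show ?thesis unfolding g_def by (rule less_mult_imp_div_less)
  qed
  moreover have "card {e \<in> E. s e = v \<and> g e = i} \<le> t" for v i
  \<comment> \<open>For \<open>t = 0\<close> the quotient defining \<open>g\<close> carries no
    information, but then there are no edges to count.\<close>
  proof (cases "t = 0")
    case True
    then have "{e \<in> E. s e = v} = {}" using deg[of v] fin by simp
    then have none: "{e \<in> E. s e = v \<and> g e = i} = {}" by blast
    show ?thesis unfolding none by simp
  next
    case False
    have "card {e \<in> E. s e = v \<and> g e = i} \<le> card {i * t..<i * t + t}"
    proof (rule card_inj_on_le)
      show "inj_on (h v) {e \<in> E. s e = v \<and> g e = i}"
        by (rule inj_on_subset[OF bij_betw_imp_inj_on[OF h[of v]]]) blast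
      show "h v ` {e \<in> E. s e = v \<and> g e = i} \<subseteq> {i * t..<i * t + t}"
        using False unfolding g_def
        by (auto simp: dividend_less_div_times add.commute)
    qed simp
    then show ?thesis by simp
  qed
  ultimately show ?thesis by blast
qed

text \<open>An orientation with in- and outdegrees at most \<open>m * t\<close> gives a bipartite graph on two
  copies of the vertex set; splitting every copy into \<open>m\<close> vertices of degree at most \<open>t\<close>
  makes the bipartite theorem applicable.\<close>

lemma even_frugal_list_colouring:
  fixes ends :: "'e \<Rightarrow> 'v set" and L :: "'e \<Rightarrow> 'c set"
  assumes fin: "finite E" and two: "\<And>e. e \<in> E \<Longrightarrow> card (ends e) = 2"
    and deg: "\<And>v. card {e \<in> E. v \<in> ends e} \<le> 2 * (m * t)"
    and L: "\<And>e. e \<in> E \<Longrightarrow> card (L e) = t"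
  shows "\<exists>c. (\<forall>e\<in>E. c e \<in> L e) \<and> (\<forall>v a. card {e \<in> E. v \<in> ends e \<and> c e = a} \<le> 2 * m)"
proof -
  obtain x y where xy: "\<And>e. e \<in> E \<Longrightarrow> ends e = {x e, y e}"
    and dx: "\<And>v. card {e \<in> E. x e = v} \<le> m * t" and dy: "\<And>v. card {e \<in> E. y e = v} \<le> m * t"
    using orientation_halving_degrees[OF fin two deg] by blast
  obtain g where g: "\<And>e. e \<in> E \<Longrightarrow> g e < m" "\<And>v i. card {e \<in> E. x e = v \<and> g e = i} \<le> t"
    using split_into_blocks[OF fin dx] by blast
  obtain h where h: "\<And>e. e \<in> E \<Longrightarrow> h e < m" "\<And>v i. card {e \<in> E. y e = v \<and> h e = i} \<le> t"
    using split_into_blocks[OF fin dy] by blast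
  have "\<exists>c. (\<forall>e\<in>E. c e \<in> L e) \<and> (\<forall>e\<in>E. \<forall>f\<in>E. e \<noteq> f \<longrightarrow>
      (x e, g e) = (x f, g f) \<or> (y e, h e) = (y f, h f) \<longrightarrow> c e \<noteq> c f)"
    by (rule bipartite_list_edge_colouring[OF fin]) (use g h L in auto)
  then obtain c where cL: "\<And>e. e \<in> E \<Longrightarrow> c e \<in> L e"
    and c: "\<And>e f. e \<in> E \<Longrightarrow> f \<in> E \<Longrightarrow> e \<noteq> f \<Longrightarrow>
      (x e, g e) = (x f, g f) \<or> (y e, h e) = (y f, h f) \<Longrightarrow> c e \<noteq> c f" by blast
  have "card {e \<in> E. v \<in> ends e \<and> c e = a} \<le> 2 * m" for v a
  proof -
    \<comment> \<open>Edges of one colour with \<open>x\<close>-end \<open>v\<close> lie in distinct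
      blocks, so there are at most \<open>m\<close> of them; the \<open>y\<close>-ends account for
      another \<open>m\<close>.\<close>
    have "card {e \<in> E. x e = v \<and> c e = a} \<le> card {..<m}"
    proof (rule card_inj_on_le[of g])
      show "inj_on g {e \<in> E. x e = v \<and> c e = a}"
        by (rule inj_onI) (use c in \<open>metis (mono_tags, lifting) mem_Collect_eq\<close>)
    qed (use g in auto)
    moreover have "card {e \<in> E. y e = v \<and> c e = a} \<le> card {..<m}"
    proof (rule card_inj_on_le[of h])
      show "inj_on h {e \<in> E. y e = v \<and> c e = a}"
        by (rule inj_onI) (use c in \<open>metis (mono_tags, lifting) mem_Collect_eq\<close>)
    qed (use h in auto)
    moreover have "{e \<in> E. v \<in> ends e \<and> c e = a}
        = {e \<in> E. x e = v \<and> c e = a} \<union> {e \<in> E. y e = v \<and> c e = a}" using xy by auto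
    ultimately show ?thesis
      using card_Un_le[of "{e \<in> E. x e = v \<and> c e = a}" "{e \<in> E. y e = v \<and> c e = a}"] by simp
  qed
  then show ?thesis using cL by blast
qed

text \<open>After orienting, the case of equal lists (Koenig's theorem) colours the associated
  bipartite graph properly with \<open>n + h\<close> colours. Each colour occurs at most twice at a
  vertex, once per direction, so the first \<open>n\<close> colours can form
  \<open>F\<close>.\<close>

lemma degree_splitting:
  fixes ends :: "'e \<Rightarrow> 'v set"
  assumes fin: "finite E" and two: "\<And>e. e \<in> E \<Longrightarrow> card (ends e) = 2"
    and deg: "\<And>v. card {e \<in> E. v \<in> ends e} \<le> 2 * (n + h)"
  shows "\<exists>F \<subseteq> E. \<forall>v. card {e \<in> F. v \<in> ends e} \<le> 2 * n \<and> card {e \<in> E - F. v \<in> ends e} \<le> 2 * h"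
proof -
  obtain x y where xy: "\<And>e. e \<in> E \<Longrightarrow> ends e = {x e, y e}"
    and dx: "\<And>v. card {e \<in> E. x e = v} \<le> n + h" and dy: "\<And>v. card {e \<in> E. y e = v} \<le> n + h"
    using orientation_halving_degrees[OF fin two deg] by blast
  have "\<exists>c. (\<forall>e\<in>E. c e \<in> {..<n + h}) \<and> (\<forall>e\<in>E. \<forall>f\<in>E. e \<noteq> f \<longrightarrow>
      x e = x f \<or> y e = y f \<longrightarrow> c e \<noteq> c f)"
    by (rule bipartite_list_edge_colouring[OF fin]) (use dx dy in auto)
  then obtain c :: "'e \<Rightarrow> nat" where cL: "\<And>e. e \<in> E \<Longrightarrow> c e < n + h"
    and c: "\<And>e f. e \<in> E \<Longrightarrow> f \<in> E \<Longrightarrow> e \<noteq> f \<Longrightarrow> x e = x f \<or> y e = y f \<Longrightarrow> c e \<noteq> c f"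
    by auto
  have bound: "card {e \<in> E. c e \<in> I \<and> v \<in> ends e} \<le> 2 * card I" if I: "finite I" for I v
  proof -
    have "card {e \<in> E. c e \<in> I \<and> x e = v} \<le> card I"
    proof (rule card_inj_on_le[of c])
      show "inj_on c {e \<in> E. c e \<in> I \<and> x e = v}"
        by (rule inj_onI) (use c in \<open>metis (mono_tags, lifting) mem_Collect_eq\<close>)
    qed (use I in auto)
    moreover have "card {e \<in> E. c e \<in> I \<and> y e = v} \<le> card I"
    proof (rule card_inj_on_le[of c])
      show "inj_on c {e \<in> E. c e \<in> I \<and> y e = v}"
        by (rule inj_onI) (use c in \<open>metis (mono_tags, lifting) mem_Collect_eq\<close>)
    qed (use I in auto)
    moreover have "{e \<in> E. c e \<in> I \<and> v \<in> ends e}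
        = {e \<in> E. c e \<in> I \<and> x e = v} \<union> {e \<in> E. c e \<in> I \<and> y e = v}" using xy by auto
    ultimately show ?thesis
      using card_Un_le[of "{e \<in> E. c e \<in> I \<and> x e = v}" "{e \<in> E. c e \<in> I \<and> y e = v}"] by simp
  qed
  have F: "{e \<in> {e \<in> E. c e < n}. v \<in> ends e} = {e \<in> E. c e \<in> {..<n} \<and> v \<in> ends e}"
    "{e \<in> E - {e \<in> E. c e < n}. v \<in> ends e} = {e \<in> E. c e \<in> {n..<n + h} \<and> v \<in> ends e}" for v
    using cL by auto
  show ?thesis
  proof (intro exI[of _ "{e \<in> E. c e < n}"] conjI allI)
    show "card {e \<in> {e \<in> E. c e < n}. v \<in> ends e} \<le> 2 * n" for v
      unfolding F using bound[of "{..<n}" v] by simp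
    show "card {e \<in> E - {e \<in> E. c e < n}. v \<in> ends e} \<le> 2 * h" for v
      unfolding F using bound[of "{n..<n + h}" v] by simp
  qed blast
qed

section \<open>The Shannon bound for list colourings\<close>

lemma greedy_list_colouring:
  fixes ends :: "'e \<Rightarrow> 'v set" and L :: "'e \<Rightarrow> 'c set"
  assumes "finite P"
    and "\<And>e. e \<in> P \<Longrightarrow> card {f \<in> P. f \<noteq> e \<and> ends f \<inter> ends e \<noteq> {}} < card (L e)"
  shows "\<exists>c. (\<forall>e\<in>P. c e \<in> L e) \<and>
    (\<forall>e\<in>P. \<forall>f\<in>P. e \<noteq> f \<longrightarrow> ends e \<inter> ends f \<noteq> {} \<longrightarrow> c e \<noteq> c f)"
  using assms
proof (induction P rule: finite_induct)
  case (insert e P)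
  have "card {f \<in> P. f \<noteq> g \<and> ends f \<inter> ends g \<noteq> {}} < card (L g)" if "g \<in> P" for g
  proof -
    have "card {f \<in> P. f \<noteq> g \<and> ends f \<inter> ends g \<noteq> {}}
        \<le> card {f \<in> insert e P. f \<noteq> g \<and> ends f \<inter> ends g \<noteq> {}}"
      using insert.hyps by (intro card_mono) auto
    then show ?thesis using insert.prems[of g] that by simp
  qed
  then obtain c where c: "\<And>e. e \<in> P \<Longrightarrow> c e \<in> L e"
    "\<And>e f. e \<in> P \<Longrightarrow> f \<in> P \<Longrightarrow> e \<noteq> f \<Longrightarrow> ends e \<inter> ends f \<noteq> {} \<Longrightarrow> c e \<noteq> c f"
    using insert.IH by blast
  let ?N = "{f \<in> insert e P. f \<noteq> e \<and> ends f \<inter> ends e \<noteq> {}}"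
  have finN: "finite ?N" using insert.hyps by simp
  have "card (c ` ?N) < card (L e)"
    using card_image_le[OF finN, of c] insert.prems[of e] by simp
  then have "\<not> L e \<subseteq> c ` ?N"
    using card_mono[OF finite_imageI[OF finN], of "L e" c] by linarith
  then obtain a where a: "a \<in> L e" "a \<notin> c ` ?N" by blast
  have a': "c f \<noteq> a" if "f \<in> P" "ends f \<inter> ends e \<noteq> {}" for f
    using a(2) that insert.hyps(2) by blast
  show ?case
  proof (intro exI[of _ "c(e := a)"] conjI ballI impI)
    show "(c(e := a)) f \<in> L f" if "f \<in> insert e P" for f using that a c by auto
    fix f g assume fg: "f \<in> insert e P" "g \<in> insert e P" "f \<noteq> g" "ends f \<inter> ends g \<noteq> {}"
    then show "(c(e := a)) f \<noteq> (c(e := a)) g"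
      using a'[of f] a'[of g] c(2)[of f g] by (auto simp: Int_commute)
  qed
qed simp

text \<open>Take a maximum cut, so that the number of edges inside the two sides is least. Moving
  \<open>v\<close> across exchanges inside and crossing edges at \<open>v\<close> and affects no
  other edge, so by minimality at most half of the edges at \<open>v\<close> are inside.\<close>

lemma half_cut_exists:
  fixes ends :: "'e \<Rightarrow> 'v set"
  assumes fin: "finite E" and two: "\<And>e. e \<in> E \<Longrightarrow> card (ends e) = 2"
  shows "\<exists>A. \<forall>v. 2 * card {e \<in> E. (ends e \<subseteq> A \<or> ends e \<subseteq> - A) \<and> v \<in> ends e} \<le> card {e \<in> E. v \<in> ends e}"
proof -
  define inside where "inside A = {e \<in> E. ends e \<subseteq> A \<or> ends e \<subseteq> - A}" for A
  have fini: "finite (inside A)" for A using fin unfolding inside_def by simp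
  obtain A where A: "\<And>B. card (inside A) \<le> card (inside B)"
    using ex_has_least_nat[of "\<lambda>_. True" undefined "\<lambda>A. card (inside A)"] by blast
  have "2 * card {e \<in> inside A. v \<in> ends e} \<le> card {e \<in> E. v \<in> ends e}" for v
  proof -
    let ?I = "{e \<in> inside A. v \<in> ends e}" and ?D = "{e \<in> E. v \<in> ends e}"
    define B where "B = (if v \<in> A then A - {v} else insert v A)"
    have toggle: "e \<in> inside B \<longleftrightarrow> e \<notin> inside A" if e: "e \<in> ?D" for e
    proof -
      obtain p q where "ends e = {p, q}" "p \<noteq> q" using two[of e] e by (auto simp: card_2_iff)
      then obtain w where "ends e = {v, w}" "w \<noteq> v" using e by (cases "v = p") auto
      then show ?thesis using e unfolding inside_def B_def by auto
    qed
    have same: "e \<in> inside B \<longleftrightarrow> e \<in> inside A" if e: "e \<notin> ?D" for e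
      using e unfolding inside_def B_def by auto
    have insB: "inside B = (inside A - ?I) \<union> (?D - ?I)"
    proof (rule set_eqI)
      fix e show "e \<in> inside B \<longleftrightarrow> e \<in> (inside A - ?I) \<union> (?D - ?I)"
        using toggle[of e] same[of e] unfolding inside_def by (cases "e \<in> ?D") blast+
    qed
    have finI: "finite ?I" using fini[of A] by (rule finite_subset[rotated]) blast
    have "card (inside B) \<le> card (inside A - ?I) + card (?D - ?I)"
      unfolding insB by (rule card_Un_le)
    also have "card (inside A - ?I) = card (inside A) - card ?I"
      by (rule card_Diff_subset[OF finI]) blast
    also have "card (?D - ?I) = card ?D - card ?I"
      by (rule card_Diff_subset[OF finI]) (auto simp: inside_def)
    finally have "card (inside A) \<le> card (inside A) - card ?I + (card ?D - card ?I)"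
      using A[of B] by linarith
    moreover have "card ?I \<le> card (inside A)" "card ?I \<le> card ?D"
      using fini fin by (auto intro!: card_mono simp: inside_def)
    ultimately show ?thesis by linarith
  qed
  then show ?thesis unfolding inside_def by (intro exI[of _ A]) (simp add: conj_assoc)
qed

text \<open>Since \<open>u\<close> and \<open>v\<close> may be exchanged, a list has at least the
  larger end degree plus half the smaller. If \<open>i\<close> counts the edges inside the sides of
  a half cut, then \<open>d u + i v\<close> is at most the list size, so inside edges can be
  coloured greedily first. A cut edge loses at most \<open>i u + i v\<close> colours and keeps
  \<open>d u - i u\<close>, its degree at \<open>u\<close> in the cut; likewise at
  \<open>v\<close>.\<close>

lemma shannon_list_edge_colouring:
  fixes ends :: "'e \<Rightarrow> 'v set" and L :: "'e \<Rightarrow> 'c set"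
  assumes fin: "finite E" and two: "\<And>e. e \<in> E \<Longrightarrow> card (ends e) = 2"
    and L: "\<And>e u v. e \<in> E \<Longrightarrow> ends e = {u, v} \<Longrightarrow>
      card {f \<in> E. u \<in> ends f} + card {f \<in> E. v \<in> ends f} div 2 \<le> card (L e)"
  shows "\<exists>c. (\<forall>e\<in>E. c e \<in> L e) \<and>
    (\<forall>e\<in>E. \<forall>f\<in>E. e \<noteq> f \<longrightarrow> ends e \<inter> ends f \<noteq> {} \<longrightarrow> c e \<noteq> c f)"
proof -
  obtain A where A: "\<And>v. 2 * card {e \<in> E. (ends e \<subseteq> A \<or> ends e \<subseteq> - A) \<and> v \<in> ends e}
      \<le> card {e \<in> E. v \<in> ends e}"
    using half_cut_exists[where ends = ends, OF fin two] by blast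
  define I where "I = {e \<in> E. ends e \<subseteq> A \<or> ends e \<subseteq> - A}"
  define d where "d v = card {e \<in> E. v \<in> ends e}" for v
  define i where "i v = card {e \<in> I. v \<in> ends e}" for v
  have finI: "finite I" and IE: "I \<subseteq> E" using fin unfolding I_def by auto
  have half: "i v \<le> d v div 2" for v
  proof -
    have eq: "{e \<in> I. v \<in> ends e} = {e \<in> E. (ends e \<subseteq> A \<or> ends e \<subseteq> - A) \<and> v \<in> ends e}"
      unfolding I_def by blast
    show ?thesis unfolding i_def d_def eq using A[of v] by linarith
  qed
  have Ld: "d u + i v \<le> card (L e)" if "e \<in> E" "ends e = {u, v}" for e u v
    using L[OF that] half[of v] unfolding d_def by linarith
  have near: "card {f \<in> I. ends f \<inter> {u, v} \<noteq> {}} \<le> i u + i v" for u v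
  proof -
    have "{f \<in> I. ends f \<inter> {u, v} \<noteq> {}} = {f \<in> I. u \<in> ends f} \<union> {f \<in> I. v \<in> ends f}" by blast
    then show ?thesis unfolding i_def by (simp add: card_Un_le)
  qed
  have "\<exists>c. (\<forall>e\<in>I. c e \<in> L e) \<and>
    (\<forall>e\<in>I. \<forall>f\<in>I. e \<noteq> f \<longrightarrow> ends e \<inter> ends f \<noteq> {} \<longrightarrow> c e \<noteq> c f)"
  proof (rule greedy_list_colouring[OF finI])
    fix e assume e: "e \<in> I"
    obtain u v where uv: "ends e = {u, v}" using two[of e] e IE by (auto simp: card_2_iff)
    have "{f \<in> I. f \<noteq> e \<and> ends f \<inter> ends e \<noteq> {}} \<subset> {f \<in> I. ends f \<inter> {u, v} \<noteq> {}}"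
      using e uv by blast
    then have "card {f \<in> I. f \<noteq> e \<and> ends f \<inter> ends e \<noteq> {}} < card {f \<in> I. ends f \<inter> {u, v} \<noteq> {}}"
      using finI by (intro psubset_card_mono) auto
    also have "\<dots> \<le> i u + i v" by (rule near)
    also have "\<dots> \<le> d u + i v" using half[of u] by linarith
    also have "\<dots> \<le> card (L e)" using Ld e IE uv by blast
    finally show "card {f \<in> I. f \<noteq> e \<and> ends f \<inter> ends e \<noteq> {}} < card (L e)" .
  qed
  then obtain c1 where c1: "\<And>e. e \<in> I \<Longrightarrow> c1 e \<in> L e"
    "\<And>e f. e \<in> I \<Longrightarrow> f \<in> I \<Longrightarrow> e \<noteq> f \<Longrightarrow> ends e \<inter> ends f \<noteq> {} \<Longrightarrow> c1 e \<noteq> c1 f" by blast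
  define H where "H = E - I"
  have finH: "finite H" and HE: "H \<subseteq> E" using fin unfolding H_def by auto
  have "\<exists>x y. ends e = {x, y} \<and> x \<in> A \<and> y \<notin> A" if eH: "e \<in> H" for e
  proof -
    obtain u v where uv: "ends e = {u, v}"
      using two[of e] eH unfolding H_def by (auto simp: card_2_iff)
    then have "u \<in> A \<and> v \<notin> A \<or> v \<in> A \<and> u \<notin> A" using eH unfolding H_def I_def by auto
    then show ?thesis using uv insert_commute[of u v "{}"] by metis
  qed
  then obtain x y where xy: "\<And>e. e \<in> H \<Longrightarrow> ends e = {x e, y e} \<and> x e \<in> A \<and> y e \<notin> A" by metis
  define L' where "L' e = L e - c1 ` {f \<in> I. ends f \<inter> ends e \<noteq> {}}" for e
  have dH: "card {f \<in> H. v \<in> ends f} + i v = d v" for v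
  proof -
    have "{f \<in> E. v \<in> ends f} = {f \<in> H. v \<in> ends f} \<union> {f \<in> I. v \<in> ends f}"
      using IE unfolding H_def by blast
    moreover have "{f \<in> H. v \<in> ends f} \<inter> {f \<in> I. v \<in> ends f} = {}" unfolding H_def by blast
    ultimately show ?thesis using finH finI unfolding d_def i_def by (simp add: card_Un_disjoint)
  qed
  have L': "card (L e) \<le> card (L' e) + (i (x e) + i (y e))" if e: "e \<in> H" for e
  proof -
    let ?N = "{f \<in> I. ends f \<inter> {x e, y e} \<noteq> {}}"
    have "card (L e) - card (c1 ` ?N) \<le> card (L' e)"
      unfolding L'_def using xy[OF e] finI by (simp add: diff_card_le_card_Diff)
    moreover have "card (c1 ` ?N) \<le> card ?N" using finI by (intro card_image_le) simp
    ultimately show ?thesis using near[of "x e" "y e"] by linarith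
  qed
  have "\<exists>c. (\<forall>e\<in>H. c e \<in> L' e) \<and>
    (\<forall>e\<in>H. \<forall>f\<in>H. e \<noteq> f \<longrightarrow> x e = x f \<or> y e = y f \<longrightarrow> c e \<noteq> c f)"
  proof (rule bipartite_list_edge_colouring[OF finH])
    fix e assume e: "e \<in> H"
    have "card {f \<in> H. x f = x e} \<le> card {f \<in> H. x e \<in> ends f}"
      using finH xy by (intro card_mono) auto
    then show "card {f \<in> H. x f = x e} \<le> card (L' e)"
      using dH[of "x e"] L'[OF e] Ld[of e "x e" "y e"] e HE xy[OF e] by fastforce
    have "card {f \<in> H. y f = y e} \<le> card {f \<in> H. y e \<in> ends f}"
      using finH xy by (intro card_mono) auto
    then show "card {f \<in> H. y f = y e} \<le> card (L' e)"
      using dH[of "y e"] L'[OF e] Ld[of e "y e" "x e"] e HE xy[OF e] by fastforce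
  qed
  then obtain c2 where c2: "\<And>e. e \<in> H \<Longrightarrow> c2 e \<in> L' e"
    "\<And>e f. e \<in> H \<Longrightarrow> f \<in> H \<Longrightarrow> e \<noteq> f \<Longrightarrow> x e = x f \<or> y e = y f \<Longrightarrow> c2 e \<noteq> c2 f" by blast
  have meet: "x e = x f \<or> y e = y f" if "e \<in> H" "f \<in> H" "ends e \<inter> ends f \<noteq> {}" for e f
    using xy[OF that(1)] xy[OF that(2)] that(3) by auto
  have cross: "c2 e \<noteq> c1 f" if "e \<in> H" "f \<in> I" "ends e \<inter> ends f \<noteq> {}" for e f
    using c2(1)[OF that(1)] that unfolding L'_def by blast
  show ?thesis
  proof (intro exI[of _ "\<lambda>e. if e \<in> I then c1 e else c2 e"] conjI ballI impI)
    show "(if e \<in> I then c1 e else c2 e) \<in> L e" if "e \<in> E" for e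
      using that c1(1)[of e] c2(1)[of e] unfolding H_def L'_def by auto
    fix e f assume ef: "e \<in> E" "f \<in> E" "e \<noteq> f" "ends e \<inter> ends f \<noteq> {}"
    have "e \<in> I \<or> e \<in> H" "f \<in> I \<or> f \<in> H" "e \<in> H \<Longrightarrow> e \<notin> I" "f \<in> H \<Longrightarrow> f \<notin> I"
      using ef unfolding H_def by auto
    then show "(if e \<in> I then c1 e else c2 e) \<noteq> (if f \<in> I then c1 f else c2 f)"
      using c1(2)[of e f] c2(2)[of e f] cross[of e f] cross[of f e] meet[of e f] ef(3,4)
      by (auto simp: Int_commute)
  qed
qed

section \<open>Frugal list colourings\<close>

text \<open>With \<open>D = 2 * t div 3\<close> and \<open>h = (D + 1) div 2\<close>, the first class may have degree
  \<open>2 * m * t\<close> and the second degree \<open>2 * h\<close>, which exceeds \<open>D\<close> if \<open>D\<close> is odd. If the first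
  class has as many edges as possible, then every edge of the second class has an end where the
  first class has full degree, hence where the second class has degree at most \<open>D\<close>; one such
  end per edge is enough for the Shannon-type theorem.\<close>

lemma odd_frugal_list_colouring:
  fixes ends :: "'e \<Rightarrow> 'v set" and L :: "'e \<Rightarrow> 'c set"
  assumes fin: "finite E" and two: "\<And>e. e \<in> E \<Longrightarrow> card (ends e) = 2"
    and deg: "\<And>v. 3 * card {e \<in> E. v \<in> ends e} \<le> t * (6 * m + 2)"
    and L: "\<And>e. e \<in> E \<Longrightarrow> card (L e) = t"
  shows "\<exists>c. (\<forall>e\<in>E. c e \<in> L e) \<and> (\<forall>v a. card {e \<in> E. v \<in> ends e \<and> c e = a} \<le> 2 * m + 1)"
proof -
  define D where "D = 2 * t div 3"
  define h where "h = (D + 1) div 2"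
  define K where "K = 2 * (m * t)"
  have degD: "card {e \<in> E. v \<in> ends e} \<le> K + D" for v
  proof -
    have "3 * card {e \<in> E. v \<in> ends e} \<le> 3 * K + 2 * t"
      using deg[of v] unfolding K_def by (simp add: algebra_simps)
    then show ?thesis unfolding D_def by linarith
  qed
  have Dh: "D \<le> 2 * h" unfolding h_def by linarith
  \<comment> \<open>The residues of \<open>t\<close> modulo 3 settle the rounding. The sum of one
    degree and half the other is at most \<open>D + h\<close> if the first is at most
    \<open>D\<close>, and at most \<open>2 * h + D div 2\<close> if the second is.\<close>
  define s where "s = t div 3"
  have "t = 3 * s \<or> t = 3 * s + 1 \<or> t = 3 * s + 2" unfolding s_def by linarith
  moreover have "D = 2 * s" if "t = 3 * s \<or> t = 3 * s + 1" using that unfolding D_def by linarith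
  moreover have "D = 2 * s + 1" if "t = 3 * s + 2" using that unfolding D_def by linarith
  ultimately have "t = 3 * s \<and> D = 2 * s \<and> h = s \<or> t = 3 * s + 1 \<and> D = 2 * s \<and> h = s \<or>
      t = 3 * s + 2 \<and> D = 2 * s + 1 \<and> h = s + 1"
    unfolding h_def by auto
  then have "D + h \<le> t" "2 * h + D div 2 \<le> t" by (elim disjE conjE; simp)+
  then have arith: "a + b div 2 \<le> t" if "a \<le> D \<or> b \<le> D" "a \<le> 2 * h" "b \<le> 2 * h" for a b
    using that div_le_mono[of b "2 * h" 2] div_le_mono[of b D 2] by auto
  define ok where "ok F \<longleftrightarrow> F \<subseteq> E \<and> (\<forall>v. card {e \<in> F. v \<in> ends e} \<le> K \<and>
    card {e \<in> E - F. v \<in> ends e} \<le> 2 * h)" for F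
  have "\<exists>F. ok F"
  proof -
    have "card {e \<in> E. v \<in> ends e} \<le> 2 * (m * t + h)" for v
      using degD[of v] Dh unfolding K_def distrib_left by linarith
    from degree_splitting[where ends = ends, OF fin two this] show ?thesis
      unfolding ok_def K_def by blast
  qed
  then obtain F0 where "ok F0" by blast
  moreover have "\<forall>F. ok F \<longrightarrow> card F < Suc (card E)"
    using card_mono[OF fin] unfolding ok_def by (simp add: less_Suc_eq_le)
  ultimately obtain F where F: "ok F" and max: "\<And>F'. ok F' \<Longrightarrow> card F' \<le> card F"
    using ex_has_greatest_nat[of ok F0 card "Suc (card E)"] by blast
  have FE: "F \<subseteq> E" and dF: "\<And>v. card {e \<in> F. v \<in> ends e} \<le> K"
    and dR: "\<And>v. card {e \<in> E - F. v \<in> ends e} \<le> 2 * h" using F unfolding ok_def by auto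
  have finF: "finite F" using FE fin finite_subset by blast
  have d_sum: "card {e \<in> F. v \<in> ends e} + card {e \<in> E - F. v \<in> ends e} \<le> K + D" for v
  proof -
    have "{e \<in> E. v \<in> ends e} = {e \<in> F. v \<in> ends e} \<union> {e \<in> E - F. v \<in> ends e}" using FE by blast
    moreover have "{e \<in> F. v \<in> ends e} \<inter> {e \<in> E - F. v \<in> ends e} = {}" by blast
    ultimately show ?thesis using degD[of v] finF fin by (simp add: card_Un_disjoint)
  qed
  \<comment> \<open>Otherwise \<open>e\<close> could be moved into \<open>F\<close>, against
    maximality.\<close>
  have full: "\<exists>v\<in>ends e. card {f \<in> F. v \<in> ends f} = K" if e: "e \<in> E - F" for e
  proof (rule ccontr)
    assume "\<not> ?thesis"
    then have less: "card {f \<in> F. v \<in> ends f} < K" if "v \<in> ends e" for v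
      using that dF[of v] by (metis le_neq_implies_less)
    have "card {f \<in> insert e F. v \<in> ends f} \<le> K" for v
    proof (cases "v \<in> ends e")
      case True
      then have "{f \<in> insert e F. v \<in> ends f} = insert e {f \<in> F. v \<in> ends f}" by blast
      then show ?thesis using less[OF True] e finF by simp
    next
      case False
      then have "{f \<in> insert e F. v \<in> ends f} = {f \<in> F. v \<in> ends f}" by blast
      then show ?thesis using dF[of v] by simp
    qed
    moreover have "card {f \<in> E - insert e F. v \<in> ends f} \<le> 2 * h" for v
      by (rule order_trans[OF card_mono dR[of v]]) (use fin in auto)
    ultimately have "ok (insert e F)" using e FE unfolding ok_def by blast
    from max[OF this] show False using e finF by simp
  qed
  obtain c1 where c1: "\<And>e. e \<in> F \<Longrightarrow> c1 e \<in> L e" "\<And>v a. card {e \<in> F. v \<in> ends e \<and> c1 e = a} \<le> 2 * m"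
    using even_frugal_list_colouring[OF finF, of ends m t L] two dF L FE unfolding K_def by blast
  have "\<exists>c. (\<forall>e\<in>E - F. c e \<in> L e) \<and>
    (\<forall>e\<in>E - F. \<forall>f\<in>E - F. e \<noteq> f \<longrightarrow> ends e \<inter> ends f \<noteq> {} \<longrightarrow> c e \<noteq> c f)"
  proof (rule shannon_list_edge_colouring)
    fix e u v assume e: "e \<in> E - F" "ends e = {u, v}"
    let ?u = "card {f \<in> E - F. u \<in> ends f}" and ?v = "card {f \<in> E - F. v \<in> ends f}"
    \<comment> \<open>Where \<open>F\<close> has degree \<open>K\<close>, at most \<open>D\<close>
      is left of the total \<open>K + D\<close>.\<close>
    have "?u \<le> D \<or> ?v \<le> D" 
      using full[OF e(1)] d_sum[of u] d_sum[of v] unfolding e(2) by auto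
    moreover have "?u \<le> 2 * h" "?v \<le> 2 * h" by (rule dR)+
    ultimately have "?u + ?v div 2 \<le> t" by (rule arith)
    then show "?u + ?v div 2 \<le> card (L e)" using L e by simp
  qed (use fin two in auto)
  then obtain c2 where c2: "\<And>e. e \<in> E - F \<Longrightarrow> c2 e \<in> L e"
    "\<And>e f. e \<in> E - F \<Longrightarrow> f \<in> E - F \<Longrightarrow> e \<noteq> f \<Longrightarrow> ends e \<inter> ends f \<noteq> {} \<Longrightarrow> c2 e \<noteq> c2 f"
    by blast
  define c where "c e = (if e \<in> F then c1 e else c2 e)" for e
  have "card {e \<in> E. v \<in> ends e \<and> c e = a} \<le> 2 * m + 1" for v a
  proof -
    let ?X = "{e \<in> F. v \<in> ends e \<and> c1 e = a}" and ?Y = "{e \<in> E - F. v \<in> ends e \<and> c2 e = a}"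
    have "{e \<in> E. v \<in> ends e \<and> c e = a} = ?X \<union> ?Y" using FE unfolding c_def by auto
    then have "card {e \<in> E. v \<in> ends e \<and> c e = a} \<le> card ?X + card ?Y" by (simp add: card_Un_le)
    \<comment> \<open>Edges at \<open>v\<close> meet pairwise, so the proper colouring
      \<open>c2\<close> uses each colour there at most once; this is the final
      \<open>+ 1\<close>.\<close>
    moreover have "card ?Y \<le> 1"
      using c2(2) fin by (subst One_nat_def, subst card_le_Suc0_iff_eq) (simp, blast)
    ultimately show ?thesis using c1(2)[of v a] by linarith
  qed
  moreover have "c e \<in> L e" if "e \<in> E" for e using c1(1) c2(1) that unfolding c_def by simp
  ultimately show ?thesis by blast
qed

section \<open>Multigraphs and the chain of inequalities\<close>

lemma degree_le_max_degree:
  assumes "is_multigraph G" and "v \<in> verts G"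
  shows "degree G v \<le> max_degree G"
  unfolding max_degree_def by (rule Max_ge) (use assms in \<open>auto simp: is_multigraph_def\<close>)

text \<open>Each of the \<open>t\<close> colours accounts for at most \<open>k\<close> edges at a
  vertex.\<close>

lemma max_degree_le_frugal_colours:
  assumes G: "is_multigraph G" and c: "\<And>e. e \<in> edges G \<Longrightarrow> c e < t" "frugal_edge_colouring k G c"
  shows "max_degree G \<le> k * t"
proof -
  have "degree G v \<le> k * t" if v: "v \<in> verts G" for v
  proof -
    have fin: "finite (incident_edges G v)"
      using G unfolding is_multigraph_def incident_edges_def by simp
    have "incident_edges G v = (\<Union>a<t. {e \<in> incident_edges G v. c e = a})"
      using c(1) unfolding incident_edges_def by auto
    then have "degree G v = card (\<Union>a<t. {e \<in> incident_edges G v. c e = a})"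
      unfolding degree_def by simp
    also have "\<dots> \<le> (\<Sum>a<t. card {e \<in> incident_edges G v. c e = a})" by (rule card_UN_le) simp
    also have "\<dots> \<le> (\<Sum>a<t. k)"
      by (rule sum_mono) (use c(2) v in \<open>auto simp: frugal_edge_colouring_def\<close>)
    finally show ?thesis by (simp add: mult.commute)
  qed
  then show ?thesis
    unfolding max_degree_def using G by (subst Max_le_iff) (auto simp: is_multigraph_def)
qed

lemma frugally_edge_choosable_odd:
  assumes G: "is_multigraph G" and t: "3 * max_degree G \<le> t * (6 * m + 2)"
  shows "frugally_edge_choosable (2 * m + 1) G t"
  unfolding frugally_edge_choosable_def
proof (intro allI impI)
  fix L :: "'b \<Rightarrow> nat set"
  assume L: "\<forall>e\<in>edges G. finite (L e) \<and> card (L e) = t"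
  have fin: "finite (edges G)" and two: "\<And>e. e \<in> edges G \<Longrightarrow> card (endpoints G e) = 2"
    and sub: "\<And>e. e \<in> edges G \<Longrightarrow> endpoints G e \<subseteq> verts G"
    using G unfolding is_multigraph_def by auto
  have deg: "3 * card {e \<in> edges G. v \<in> endpoints G e} \<le> t * (6 * m + 2)" for v
  proof (cases "v \<in> verts G")
    case True
    then show ?thesis
      using degree_le_max_degree[OF G True] t unfolding degree_def incident_edges_def by linarith
  next
    case False
    then have none: "{e \<in> edges G. v \<in> endpoints G e} = {}" using sub by blast
    show ?thesis unfolding none by simp
  qed
  obtain c where c: "\<And>e. e \<in> edges G \<Longrightarrow> c e \<in> L e"
    "\<And>v a. card {e \<in> edges G. v \<in> endpoints G e \<and> c e = a} \<le> 2 * m + 1"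
    using odd_frugal_list_colouring[OF fin two deg, of L] L by blast
  have "{e \<in> incident_edges G v. c e = a} = {e \<in> edges G. v \<in> endpoints G e \<and> c e = a}" for v a
    unfolding incident_edges_def by blast
  then have "frugal_edge_colouring (2 * m + 1) G c"
    using c(2) unfolding frugal_edge_colouring_def by simp
  then show "\<exists>c. (\<forall>e\<in>edges G. c e \<in> L e) \<and> frugal_edge_colouring (2 * m + 1) G c"
    using c(1) by blast
qed

theorem theorem18:
  fixes G :: "('v, 'e) multigraph" and k :: nat
  assumes "odd k" and "is_multigraph G"
  shows "\<lceil>real (max_degree G) / real k\<rceil> \<le> int (frugal_chromatic_index k G)
    \<and> frugal_chromatic_index k G \<le> frugal_choice_index k G
    \<and> int (frugal_choice_index k G) \<le> \<lceil>3 * real (max_degree G) / (3 * real k - 1)\<rceil>"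
proof -
  obtain m where k: "k = 2 * m + 1" using \<open>odd k\<close> by (rule oddE)
  \<comment> \<open>This is the least \<open>t\<close> for which \<open>t * (3 * k - 1)\<close>
    reaches \<open>3 * max_degree G\<close>, and \<open>3 * k - 1 = 6 * m + 2\<close>.\<close>
  define t where "t = nat \<lceil>3 * real (max_degree G) / (3 * real k - 1)\<rceil>"
  have pos: "0 < 3 * real k - 1" unfolding k by simp
  then have nonneg: "0 \<le> 3 * real (max_degree G) / (3 * real k - 1)" by simp
  then have t_int: "int t = \<lceil>3 * real (max_degree G) / (3 * real k - 1)\<rceil>" unfolding t_def by simp
  have "3 * real (max_degree G) / (3 * real k - 1) \<le> real t"
    unfolding t_def by (rule real_nat_ceiling_ge)
  then have "3 * real (max_degree G) \<le> real t * (3 * real k - 1)"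
    using pos by (simp add: pos_divide_le_eq)
  also have "\<dots> = real (t * (6 * m + 2))" unfolding k by (simp add: algebra_simps)
  finally have "3 * max_degree G \<le> t * (6 * m + 2)" by linarith
  then have ch: "frugally_edge_choosable k G t"
    unfolding k by (rule frugally_edge_choosable_odd[OF assms(2)])
  let ?s = "frugal_choice_index k G"
  have "frugally_edge_choosable k G ?s" unfolding frugal_choice_index_def by (rule LeastI) (rule ch)
  \<comment> \<open>Giving every edge the list of colours below \<open>?s\<close> turns choosability
    into an ordinary colouring. It also ensures that the minimum defining the chromatic index is
    attained.\<close>
  then have "\<exists>c :: 'e \<Rightarrow> nat. (\<forall>e\<in>edges G. c e \<in> {..<?s}) \<and> frugal_edge_colouring k G c"
    unfolding frugally_edge_choosable_def by (elim allE[of _ "\<lambda>_. {..<?s}"]) simp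
  then have col: "\<exists>c :: 'e \<Rightarrow> nat. (\<forall>e\<in>edges G. c e < ?s) \<and> frugal_edge_colouring k G c" by simp
  have chi_ch: "frugal_chromatic_index k G \<le> ?s"
    unfolding frugal_chromatic_index_def by (rule Least_le) (rule col)
  have "\<exists>c :: 'e \<Rightarrow> nat. (\<forall>e\<in>edges G. c e < frugal_chromatic_index k G) \<and> frugal_edge_colouring k G c"
    unfolding frugal_chromatic_index_def by (rule LeastI) (rule col)
  then have "max_degree G \<le> k * frugal_chromatic_index k G"
    using max_degree_le_frugal_colours[OF assms(2)] by blast
  then have "real (max_degree G) \<le> real (k * frugal_chromatic_index k G)" by (rule of_nat_mono)
  then have "real (max_degree G) / real k \<le> real (frugal_chromatic_index k G)"
    unfolding k by (simp add: pos_divide_le_eq algebra_simps)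
  then have lower: "\<lceil>real (max_degree G) / real k\<rceil> \<le> int (frugal_chromatic_index k G)"
    by (simp add: ceiling_le_iff)
  have "?s \<le> t" unfolding frugal_choice_index_def by (rule Least_le) (rule ch)
  then have "int ?s \<le> \<lceil>3 * real (max_degree G) / (3 * real k - 1)\<rceil>" unfolding t_int[symmetric] by simp
  then show ?thesis using lower chi_ch by blast
qed

end
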